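(* Let $d\ge 1$ and let $(\Gamma_1,\dots,\Gamma_d)$ be a cycle-free $d$-partition of $K_{2d}$. Then there exists a cycle-free $d$-partition $(\Upsilon_1,\dots,\Upsilon_d)$ of $K_{2d}$ that is involution equivalent to $(\Gamma_1,\dots,\Gamma_d)$ and such that the graph $\Upsilon_d$ is isomorphic to the path graph $I_{2d}$.
   Context: All graphs are simple and undirected; $(i,j)$ and $(j,i)$ denote the same edge. $K_n$ is the complete graph on $\{1,\dots,n\}$. A $d$-partition of $K_n$ is an ordered tuple $(\Gamma_1,\dots,\Gamma_d)$ of subgraphs of $K_n$, each with vertex set $\{1,\dots,n\}$, whose edge sets are pairwise disjoint and have union $E(K_n)$. It is cycle-free if no $\Gamma_i$ contains a cycle. $\mathcal{P}_d^{cf}(K_{2d})$ is the set of cycle-free $d$-partitions of $K_{2d}$. The path graph $I_{2d}$ has vertices $1,\dots,2d$ and edges $(i,i+1)$ for $1\le i\le 2d-1$. Involutions: it is known that for every $\mathcal{P}\in\mathcal{P}_d^{cf}(K_{2d})$ and distinct vertices $x,y,z$ there is a unique $\mathcal{Q}\in\mathcal{P}_d^{cf}(K_{2d})$ such that $\mathcal{P}$ and $\mathcal{Q}$ coincide (assign the edge to the component of the same index) on every edge of $K_{2d}$ other than $(x,y),(x,z),(y,z)$, and differ on at least two of these three edges. This $\mathcal{Q}$ is denoted $\mathcal{P}^{(x,y,z)}$; the map $\mathcal{P}\mapsto\mathcal{P}^{(x,y,z)}$ is an involution. Involution equivalence: $\mathcal{P},\mathcal{Q}\in\mathcal{P}_d^{cf}(K_{2d})$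 are involution equivalent if there are $n\ge 0$, $\mathcal{P}_0,\dots,\mathcal{P}_n\in\mathcal{P}_d^{cf}(K_{2d})$ and $1\le x_i<y_i<z_i\le 2d$ ($1\le i\le n$) with $\mathcal{P}_0=\mathcal{P}$, $\mathcal{P}_n=\mathcal{Q}$ and $\mathcal{P}_i^{(x_i,y_i,z_i)}=\mathcal{P}_{i-1}$ for all $1\le i\le n$. *)

theory Defs
  imports Main
begin

text \<open>A graph is a vertex set together with a set of edges; an edge is the two-element set of its
  endpoints, so that \<open>(i,j)\<close> and \<open>(j,i)\<close> are the same edge.\<close>

type_synonym 'a ugraph = "'a set \<times> 'a set set"

abbreviation uverts :: "'a ugraph \<Rightarrow> 'a set" where "uverts G \<equiv> fst G"
abbreviation uedges :: "'a ugraph \<Rightarrow> 'a set set" where "uedges G \<equiv> snd G"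

definition simple_graph :: "'a ugraph \<Rightarrow> bool" where
  "simple_graph G \<longleftrightarrow> (\<forall>e\<in>uedges G. e \<subseteq> uverts G \<and> card e = 2)"

definition is_subgraph :: "'a ugraph \<Rightarrow> 'a ugraph \<Rightarrow> bool" where
  "is_subgraph H G \<longleftrightarrow> simple_graph H \<and> uverts H \<subseteq> uverts G \<and> uedges H \<subseteq> uedges G"

definition graph_isomorphic :: "'a ugraph \<Rightarrow> 'b ugraph \<Rightarrow> bool" where
  "graph_isomorphic G H \<longleftrightarrow>
     (\<exists>f. bij_betw f (uverts G) (uverts H) \<and>
          (\<forall>u\<in>uverts G. \<forall>v\<in>uverts G. {u, v} \<in> uedges G \<longleftrightarrow> {f u, f v} \<in> uedges H))"

text \<open>A cycle is given by the list of its vertices without repeating the first one at the end.\<close>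

definition is_cycle :: "'a ugraph \<Rightarrow> 'a list \<Rightarrow> bool" where
  "is_cycle G c \<longleftrightarrow> 3 \<le> length c \<and> distinct c \<and> set c \<subseteq> uverts G \<and>
     (\<forall>i<length c. {c ! i, c ! (Suc i mod length c)} \<in> uedges G)"

definition complete_graph :: "nat \<Rightarrow> nat ugraph" where
  "complete_graph n = ({1..n}, {{i, j} |i j. i \<in> {1..n} \<and> j \<in> {1..n} \<and> i \<noteq> j})"

definition path_graph :: "nat \<Rightarrow> nat ugraph" where
  "path_graph n = ({1..n}, {{i, i + 1} |i. 1 \<le> i \<and> i < n})"

text \<open>A tuple \<open>(\<Gamma>\<^sub>1, \<dots>, \<Gamma>\<^sub>d)\<close> is a list of length \<open>d\<close>, so \<open>\<Gamma>\<^sub>i\<close> is the list entry with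
  index \<open>i - 1\<close>.\<close>

definition d_partition :: "nat \<Rightarrow> nat \<Rightarrow> nat ugraph list \<Rightarrow> bool" where
  "d_partition d n P \<longleftrightarrow> length P = d \<and>
     (\<forall>i<d. is_subgraph (P ! i) (complete_graph n) \<and> uverts (P ! i) = {1..n}) \<and>
     (\<forall>i<d. \<forall>j<d. i \<noteq> j \<longrightarrow> uedges (P ! i) \<inter> uedges (P ! j) = {}) \<and>
     (\<Union>i<d. uedges (P ! i)) = uedges (complete_graph n)"

definition cycle_free :: "nat ugraph list \<Rightarrow> bool" where
  "cycle_free P \<longleftrightarrow> (\<forall>i<length P. \<not> (\<exists>c. is_cycle (P ! i) c))"

definition cf_partitions :: "nat \<Rightarrow> nat ugraph list set" where
  "cf_partitions d = {P. d_partition d (2 * d) P \<and> cycle_free P}"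

definition coincide_on :: "nat ugraph list \<Rightarrow> nat ugraph list \<Rightarrow> nat set \<Rightarrow> bool" where
  "coincide_on P Q e \<longleftrightarrow> (\<forall>i<length P. e \<in> uedges (P ! i) \<longleftrightarrow> e \<in> uedges (Q ! i))"

text \<open>The partition \<open>P\<^bsup>(x,y,z)\<^esup>\<close>. The description is meaningful because such a \<open>Q\<close> exists and is unique
  for every \<open>P \<in> cf_partitions d\<close> and distinct \<open>x, y, z \<in> {1..2 * d}\<close>.\<close>

definition involution ::
    "nat \<Rightarrow> nat ugraph list \<Rightarrow> nat \<Rightarrow> nat \<Rightarrow> nat \<Rightarrow> nat ugraph list" where
  "involution d P x y z = (THE Q. Q \<in> cf_partitions d \<and>
     (\<forall>e \<in> uedges (complete_graph (2 * d)) - {{x, y}, {x, z}, {y, z}}. coincide_on P Q e) \<and>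
     2 \<le> card {e \<in> {{x, y}, {x, z}, {y, z}}. \<not> coincide_on P Q e})"

definition involution_equivalent ::
    "nat \<Rightarrow> nat ugraph list \<Rightarrow> nat ugraph list \<Rightarrow> bool" where
  "involution_equivalent d P Q \<longleftrightarrow>
     (\<exists>(n::nat) (R :: nat \<Rightarrow> nat ugraph list) (x :: nat \<Rightarrow> nat) (y :: nat \<Rightarrow> nat) (z :: nat \<Rightarrow> nat).
        (\<forall>i\<le>n. R i \<in> cf_partitions d) \<and> R 0 = P \<and> R n = Q \<and>
        (\<forall>i\<in>{1..n}. 1 \<le> x i \<and> x i < y i \<and> y i < z i \<and> z i \<le> 2 * d \<and>
            involution d (R i) (x i) (y i) (z i) = R (i - 1)))"

end

theory Submission
  imports Defs
begin

text \<open>Counting edges shows that all components of a cycle-free \<open>d\<close>-partition of \<open>K\<^bsub>2d\<^esub>\<close> are spanning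
  trees. If the tree \<open>T = \<Gamma>\<^sub>d\<close> contains the edges \<open>uv\<close> and \<open>vw\<close>, then the involution at \<open>(u, v, w)\<close>
  replaces \<open>T\<close> by \<open>T - uv + uw\<close> or by \<open>T - vw + uw\<close>. Apply this to consecutive vertices \<open>v\<close>, \<open>w\<close> of a
  path in \<open>T\<close> and a neighbour \<open>u\<close> of \<open>v\<close> off the path: the second outcome lengthens the path, the
  first one moves the attachment point of \<open>u\<close> one step further along the path. At the last vertex
  of the path, \<open>u\<close> can simply be appended. So the path grows until it spans \<open>T\<close>.\<close>

section \<open>Forests\<close>

definition adj :: "'a set set \<Rightarrow> ('a \<times> 'a) set" where
  "adj E = {(u, v). {u, v} \<in> E}"

abbreviation conn :: "'a set set \<Rightarrow> ('a \<times> 'a) set" where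
  "conn E \<equiv> (adj E)\<^sup>*"

text \<open>Every edge is a bridge, so that edge exchanges become questions of reachability. Loops
  are excluded as well, since \<open>conn\<close> is reflexive.\<close>

definition forest :: "'a set set \<Rightarrow> bool" where
  "forest E \<longleftrightarrow> (\<forall>u v. {u, v} \<in> E \<longrightarrow> (u, v) \<notin> conn (E - {{u, v}}))"

lemma adj_conn: "{u, v} \<in> E \<Longrightarrow> (u, v) \<in> conn E"
  by (auto simp: adj_def)

lemma conn_sym: "(u, v) \<in> conn E \<Longrightarrow> (v, u) \<in> conn E"
proof -
  have "sym (adj E)"
    by (auto simp: adj_def sym_def insert_commute)
  then show "(u, v) \<in> conn E \<Longrightarrow> (v, u) \<in> conn E"
    by (meson sym_rtrancl symD)
qed

lemma conn_mono: "E \<subseteq> F \<Longrightarrow> (u, v) \<in> conn E \<Longrightarrow> (u, v) \<in> conn F"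
  by (rule rtrancl_mono[THEN subsetD]) (auto simp: adj_def)

text \<open>A walk can be shortened so that it crosses the new edge at most once, in one of the two
  directions.\<close>

lemma conn_insert:
  assumes "(a, b) \<in> conn (insert {x, y} E)"
  shows "(a, b) \<in> conn E \<or> (a, x) \<in> conn E \<and> (y, b) \<in> conn E
    \<or> (a, y) \<in> conn E \<and> (x, b) \<in> conn E"
  using assms
proof (induction rule: rtrancl_induct)
  case base
  then show ?case by simp
next
  case (step b c)
  show ?case
  proof (cases "{b, c} \<in> E")
    case True
    then have "(b, c) \<in> adj E"
      by (simp add: adj_def)
    then show ?thesis
      using step.IH by (meson rtrancl.rtrancl_into_rtrancl)
  next
    case False
    then have "b = x \<and> c = y \<or> b = y \<and> c = x"
      using step.hyps(2) by (auto simp: adj_def doubleton_eq_iff)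
    then show ?thesis
      using step.IH by (metis rtrancl.rtrancl_refl rtrancl_trans)
  qed
qed

lemma forest_subset: "forest F \<Longrightarrow> E \<subseteq> F \<Longrightarrow> forest E"
  unfolding forest_def by (meson Diff_mono conn_mono order_refl subsetD)

lemma forest_edge: "forest E \<Longrightarrow> {u, v} \<in> E \<Longrightarrow> (u, v) \<notin> conn (E - {{u, v}})"
  by (simp add: forest_def)

text \<open>If an old edge \<open>{a, b}\<close> stopped being a bridge, the detour around it would
  cross \<open>{u, v}\<close>; together with \<open>{a, b}\<close> it would link \<open>u\<close> to
  \<open>v\<close> inside \<open>F\<close>.\<close>

lemma forest_insert:
  assumes "forest F" and uv: "(u, v) \<notin> conn F"
  shows "forest (insert {u, v} F)"
  unfolding forest_def
proof (intro allI impI notI)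
  fix a b
  assume ab: "{a, b} \<in> insert {u, v} F"
    and c: "(a, b) \<in> conn (insert {u, v} F - {{a, b}})"
  show False
  proof (cases "{a, b} = {u, v}")
    case True
    then have "(a, b) \<in> conn F"
      using conn_mono[OF _ c, of F] by auto
    then show False
      using True uv conn_sym by (metis doubleton_eq_iff)
  next
    case False
    then have e: "{a, b} \<in> F"
      using ab by simp
    have "insert {u, v} F - {{a, b}} = insert {u, v} (F - {{a, b}})"
      using False by auto
    then consider "(a, b) \<in> conn (F - {{a, b}})"
      | "(a, u) \<in> conn (F - {{a, b}})" "(v, b) \<in> conn (F - {{a, b}})"
      | "(a, v) \<in> conn (F - {{a, b}})" "(u, b) \<in> conn (F - {{a, b}})"
      using conn_insert c by metis
    then show False
    proof cases
      case 1
      then show False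
        using forest_edge[OF assms(1) e] by simp
    next
      case 2
      then have "(a, u) \<in> conn F" "(v, b) \<in> conn F"
        by (auto elim: conn_mono[rotated])
      then show False
        using uv adj_conn[OF e] conn_sym by (meson rtrancl_trans)
    next
      case 3
      then have "(a, v) \<in> conn F" "(u, b) \<in> conn F"
        by (auto elim: conn_mono[rotated])
      then show False
        using uv adj_conn[OF e] conn_sym by (meson rtrancl_trans)
    qed
  qed
qed

section \<open>Counting the edges of a forest\<close>

lemma not_inj_card_less:
  assumes "finite A" "a \<in> A" "b \<in> A" "a \<noteq> b" "f a = f b"
  shows "card (f ` A) < card A"
  using assms by (metis card_image_le inj_onD inj_on_iff_eq_card le_neq_implies_less)

text \<open>The second summand counts connected components. Each inserted edge is a bridge and
  merges two of them, so the sum never grows.\<close>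

lemma forest_card_components:
  assumes "finite E" "finite V" "forest E" "\<forall>e\<in>E. e \<subseteq> V \<and> card e = 2"
  shows "card E + card ((\<lambda>v. conn E `` {v}) ` V) \<le> card V"
  using assms(1,3,4)
proof (induction E rule: finite_induct)
  case empty
  then show ?case
    by (simp add: card_image_le assms(2))
next
  case (insert e E)
  obtain u v where e: "e = {u, v}" "u \<noteq> v"
    using insert.prems(2) by (meson card_2_iff insertI1)
  let ?C = "\<lambda>E v. conn E `` {v}" and ?E' = "insert e E"
  have "u \<in> V" "v \<in> V"
    using insert.prems(2) e by auto
  have "(u, v) \<notin> conn E"
    using forest_edge[OF insert.prems(1), of u v] insert.hyps(2) e by simp
  then have ne: "?C E u \<noteq> ?C E v"
    by auto
  \<comment> \<open>Closing an old component under the new connectivity yields the new component.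
    This maps old components onto new ones and identifies those of \<open>u\<close> and
    \<open>v\<close>.\<close>
  have absorb: "conn ?E' `` ?C E w = ?C ?E' w" for w
  proof
    show "conn ?E' `` ?C E w \<subseteq> ?C ?E' w"
      by (auto intro: rtrancl_trans conn_mono[of E ?E'])
  qed auto
  have "(u, v) \<in> conn ?E'"
    by (simp add: e adj_conn)
  then have "?C ?E' u = ?C ?E' v"
    using conn_sym[OF \<open>(u, v) \<in> conn ?E'\<close>] by (auto intro: rtrancl_trans)
  then have "card ((\<lambda>C. conn ?E' `` C) ` ?C E ` V) < card (?C E ` V)"
    using \<open>u \<in> V\<close> \<open>v \<in> V\<close> ne assms(2) absorb
    by (intro not_inj_card_less[of _ "?C E u" "?C E v"]) auto
  then have "card (?C ?E' ` V) < card (?C E ` V)"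
    by (simp add: image_image absorb)
  moreover have "card E + card (?C E ` V) \<le> card V"
    using insert.prems by (intro insert.IH) (auto elim: forest_subset)
  ultimately show ?case
    using insert.hyps by simp
qed

lemma finite_edges: "finite V \<Longrightarrow> \<forall>e\<in>E. e \<subseteq> V \<and> card e = 2 \<Longrightarrow> finite E"
  by (meson PowI finite_Pow_iff finite_subset subsetI)

lemma forest_card_less:
  assumes "finite V" "V \<noteq> {}" "forest E" "\<forall>e\<in>E. e \<subseteq> V \<and> card e = 2"
  shows "card E < card V"
proof -
  have "card ((\<lambda>v. conn E `` {v}) ` V) > 0"
    using assms by (simp add: card_gt_0_iff)
  then show ?thesis
    using forest_card_components[OF finite_edges[OF assms(1,4)] assms(1,3,4)] by linarith
qed

text \<open>Joining two unconnected vertices would give a forest with at least \<open>card V\<close>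
  edges.\<close>

lemma max_forest_connected:
  assumes "finite V" "forest E" "\<forall>e\<in>E. e \<subseteq> V \<and> card e = 2" "card V \<le> Suc (card E)"
    and "u \<in> V" "v \<in> V"
  shows "(u, v) \<in> conn E"
proof (rule ccontr)
  assume uv: "(u, v) \<notin> conn E"
  then have "u \<noteq> v" "{u, v} \<notin> E"
    by (auto dest: adj_conn)
  then have "card (insert {u, v} E) = Suc (card E)"
    using finite_edges[OF assms(1,3)] by simp
  moreover have "card (insert {u, v} E) < card V"
    using assms \<open>u \<noteq> v\<close> forest_insert[OF assms(2) uv] by (intro forest_card_less) auto
  ultimately show False
    using assms(4) by simp
qed

text \<open>Without \<open>{x, y}\<close> its ends are separated, while \<open>z\<close> is still
  joined to \<open>y\<close>; so the new edge joins different components.\<close>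

lemma forest_exchange:
  assumes "forest E" "{x, y} \<in> E" "{y, z} \<in> E" "{y, z} \<noteq> {x, y}"
  shows "forest (insert {x, z} (E - {{x, y}}))"
proof (rule forest_insert)
  show "forest (E - {{x, y}})"
    using assms(1) by (rule forest_subset) auto
  show "(x, z) \<notin> conn (E - {{x, y}})"
  proof
    assume "(x, z) \<in> conn (E - {{x, y}})"
    moreover have "(z, y) \<in> conn (E - {{x, y}})"
      using assms(3,4) by (intro adj_conn) (auto simp: insert_commute)
    ultimately show False
      using forest_edge[OF assms(1,2)] by (meson rtrancl_trans)
  qed
qed

section \<open>Paths and cycles\<close>

abbreviation edge_path :: "'a set set \<Rightarrow> 'a list \<Rightarrow> bool" where
  "edge_path E \<equiv> successively (\<lambda>a b. {a, b} \<in> E)"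

lemma conn_imp_path:
  assumes "(u, v) \<in> conn E"
  shows "\<exists>xs. xs \<noteq> [] \<and> distinct xs \<and> hd xs = u \<and> last xs = v \<and> edge_path E xs"
  using assms
proof (induction rule: rtrancl_induct)
  case base
  show ?case
    by (rule exI[of _ "[u]"]) simp
next
  case (step v w)
  then obtain xs where xs: "xs \<noteq> []" "distinct xs" "hd xs = u" "last xs = v" "edge_path E xs"
    by auto
  show ?case
  proof (cases "w \<in> set xs")
    case True
    \<comment> \<open>If the walk returns to \<open>w\<close>, keep only the initial segment ending
      there.\<close>
    then obtain as bs where "xs = as @ w # bs"
      by (auto simp: in_set_conv_decomp)
    then show ?thesis
      using xs by (intro exI[of _ "as @ [w]"])
        (auto simp: successively_append_iff hd_append split: if_splits)
  next
    case False
    then show ?thesis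
      using xs step.hyps(2) by (intro exI[of _ "xs @ [w]"])
        (auto simp: successively_append_iff adj_def)
  qed
qed

lemma edge_path_mem:
  assumes "edge_path E xs" "2 \<le> length xs" "a \<in> set xs"
  shows "\<exists>e\<in>E. a \<in> e"
proof -
  obtain i where i: "i < length xs" "a = xs ! i"
    using assms(3) by (auto simp: in_set_conv_nth)
  show ?thesis
  proof (cases "Suc i < length xs")
    case True
    then show ?thesis
      using assms(1) i by (auto simp: successively_conv_nth)
  next
    case False
    then obtain k where "i = Suc k"
      using i assms(2) by (cases i) auto
    then show ?thesis
      using assms(1) i by (auto simp: successively_conv_nth)
  qed
qed

lemma edge_path_Diff:
  "edge_path E xs \<Longrightarrow> \<not> e \<subseteq> set xs \<Longrightarrow> edge_path (E - {e}) xs"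
  by (induction xs rule: induct_list012) auto

lemma edge_path_mono: "edge_path E xs \<Longrightarrow> E \<subseteq> F \<Longrightarrow> edge_path F xs"
  by (erule successively_mono) auto

text \<open>A simple path around an edge closes up to a cycle; conversely, the rest of a cycle is a
  detour around its closing edge.\<close>

lemma acyclic_iff_forest:
  assumes "simple_graph G"
  shows "(\<nexists>c. is_cycle G c) \<longleftrightarrow> forest (uedges G)"
proof
  assume acyc: "\<nexists>c. is_cycle G c"
  show "forest (uedges G)"
    unfolding forest_def
  proof (intro allI impI notI)
    fix u v
    assume uv: "{u, v} \<in> uedges G" and "(u, v) \<in> conn (uedges G - {{u, v}})"
    then obtain xs where xs: "xs \<noteq> []" "distinct xs" "hd xs = u" "last xs = v"
      "edge_path (uedges G - {{u, v}}) xs"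
      using conn_imp_path by metis
    have "u \<noteq> v"
      using assms uv by (auto simp: simple_graph_def)
    \<comment> \<open>One vertex would mean \<open>u = v\<close>; two would mean crossing the
      removed edge.\<close>
    have len: "3 \<le> length xs"
    proof (rule ccontr)
      assume "\<not> 3 \<le> length xs"
      then have "length xs = 1 \<or> length xs = 2"
        using xs(1) by (simp add: not_le less_Suc_eq numeral_3_eq_3 numeral_2_eq_2)
      then show False
        using xs(3-5) \<open>u \<noteq> v\<close> by (auto simp: length_Suc_conv numeral_2_eq_2)
    qed
    have path: "edge_path (uedges G) xs"
      using xs(5) by (rule edge_path_mono) auto
    have "is_cycle G xs"
      unfolding is_cycle_def
    proof (intro conjI allI impI)
      show "set xs \<subseteq> uverts G"
        using edge_path_mem[OF path] len assms by (fastforce simp: simple_graph_def)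
    next
      fix i
      assume i: "i < length xs"
      show "{xs ! i, xs ! (Suc i mod length xs)} \<in> uedges G"
      proof (cases "Suc i < length xs")
        case True
        then show ?thesis
          using path by (auto simp: successively_conv_nth)
      next
        case False
        then have "Suc i = length xs"
          using i by simp
        then have "xs ! i = v" "xs ! (Suc i mod length xs) = u"
          using xs(1,3,4) by (simp_all add: last_conv_nth hd_conv_nth flip: \<open>Suc i = length xs\<close>)
        then show ?thesis
          using uv by (simp add: insert_commute)
      qed
    qed (use xs len in auto)
    then show False
      using acyc by blast
  qed
next
  assume F: "forest (uedges G)"
  show "\<nexists>c. is_cycle G c"
  proof
    assume "\<exists>c. is_cycle G c"
    then obtain c where c: "3 \<le> length c" "distinct c"
      "\<And>i. i < length c \<Longrightarrow> {c ! i, c ! (Suc i mod length c)} \<in> uedges G"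
      by (auto simp: is_cycle_def)
    define m where "m = length c - 1"
    have m: "length c = Suc m" "2 \<le> m"
      using c(1) by (auto simp: m_def)
    let ?e = "{c ! 0, c ! m}"
    have e: "?e \<in> uedges G"
      using c(3)[of m] m by (simp add: insert_commute)
    \<comment> \<open>Going round the other way reaches the far end of \<open>?e\<close> without
      using it.\<close>
    have "k \<le> m \<Longrightarrow> (c ! 0, c ! k) \<in> conn (uedges G - {?e})" for k
    proof (induction k)
      case (Suc k)
      have "{c ! k, c ! Suc k} \<in> uedges G"
        using c(3)[of k] Suc.prems m by simp
      moreover have "{c ! k, c ! Suc k} \<noteq> ?e"
        using Suc.prems m c(2) by (auto simp: doubleton_eq_iff nth_eq_iff_index_eq)
      ultimately have "(c ! k, c ! Suc k) \<in> conn (uedges G - {?e})"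
        by (intro adj_conn) auto
      then show ?case
        using Suc by (meson Suc_leD rtrancl_trans)
    qed simp
    then show False
      using forest_edge[OF F e] by blast
  qed
qed

section \<open>Cycle-free partitions\<close>

lemma complete_edges: "uedges (complete_graph n) = {e. e \<subseteq> {1..n} \<and> card e = 2}"
  by (fastforce simp: complete_graph_def card_2_iff)

text \<open>Working form of the definition: acyclicity becomes the bridge condition, and the
  subgraph condition on edges follows from covering.\<close>

lemma cf_partitions_iff:
  "P \<in> cf_partitions d \<longleftrightarrow> length P = d \<and>
     (\<forall>i<d. uverts (P ! i) = {1..2 * d} \<and> forest (uedges (P ! i))) \<and>
     (\<forall>i<d. \<forall>j<d. i \<noteq> j \<longrightarrow> uedges (P ! i) \<inter> uedges (P ! j) = {}) \<and>
     (\<Union>i<d. uedges (P ! i)) = uedges (complete_graph (2 * d))" (is "?L \<longleftrightarrow> ?R")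
proof
  assume L: ?L
  then have "simple_graph (P ! i)" if "i < d" for i
    using that by (auto simp: cf_partitions_def d_partition_def is_subgraph_def)
  then have "forest (uedges (P ! i))" if "i < d" for i
    using that L acyclic_iff_forest[of "P ! i"]
    by (auto simp: cf_partitions_def d_partition_def cycle_free_def)
  then show ?R
    using L by (auto simp: cf_partitions_def d_partition_def)
next
  assume R: ?R
  have sub: "uedges (P ! i) \<subseteq> uedges (complete_graph (2 * d))" if "i < d" for i
    using R that by blast
  have sg: "simple_graph (P ! i)" if "i < d" for i
    using R that sub[OF that] by (auto simp: simple_graph_def complete_edges)
  then have "\<not> is_cycle (P ! i) c" if "i < d" for i c
    using that R acyclic_iff_forest[of "P ! i"] by blast
  then show ?L
    using R sg sub
    by (simp add: cf_partitions_def d_partition_def cycle_free_def is_subgraph_def)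
       (simp add: complete_graph_def)
qed

lemma card_complete: "card (uedges (complete_graph (2 * d))) = d * (2 * d - 1)"
  using n_subsets[of "{1..2 * d}" 2] by (simp add: complete_edges choose_two)

context
  fixes d :: nat and P :: "nat ugraph list"
  assumes P: "P \<in> cf_partitions d"
begin

lemma cf_length: "length P = d"
  using P by (simp add: cf_partitions_iff)

lemma cf_verts: "i < d \<Longrightarrow> uverts (P ! i) = {1..2 * d}"
  using P by (simp add: cf_partitions_iff)

lemma cf_forest: "i < d \<Longrightarrow> forest (uedges (P ! i))"
  using P by (simp add: cf_partitions_iff)

lemma cf_disjoint: "\<lbrakk>i < d; j < d; e \<in> uedges (P ! i); e \<in> uedges (P ! j)\<rbrakk> \<Longrightarrow> i = j"
  using P unfolding cf_partitions_iff by blast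

lemma cf_cover: "(\<Union>i<d. uedges (P ! i)) = uedges (complete_graph (2 * d))"
  using P by (simp add: cf_partitions_iff)

lemma cf_edge: "i < d \<Longrightarrow> e \<in> uedges (P ! i) \<Longrightarrow> e \<subseteq> {1..2 * d} \<and> card e = 2"
  using cf_cover by (auto simp: complete_edges)

lemma cf_finite: "i < d \<Longrightarrow> finite (uedges (P ! i))"
  using cf_edge by (intro finite_edges[of "{1..2 * d}"]) auto

text \<open>Each of the \<open>d\<close> forests has at most \<open>2 * d - 1\<close> edges, and together they have
  \<open>d * (2 * d - 1)\<close>.\<close>

lemma cf_card:
  assumes "i < d"
  shows "card (uedges (P ! i)) = 2 * d - 1"
proof (rule ccontr)
  assume ne: "card (uedges (P ! i)) \<noteq> 2 * d - 1"
  have le: "card (uedges (P ! j)) \<le> 2 * d - 1" if "j < d" for j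
    using forest_card_less[of "{1..2 * d}" "uedges (P ! j)"] cf_forest[OF that] cf_edge[OF that]
      that by auto
  have "d * (2 * d - 1) = (\<Sum>j<d. card (uedges (P ! j)))"
    unfolding card_complete[symmetric] cf_cover[symmetric]
    by (rule card_UN_disjoint) (use cf_finite cf_disjoint in blast)+
  also have "\<dots> < (\<Sum>j<d. 2 * d - 1)"
    using le ne assms by (intro sum_strict_mono_ex1) (auto intro!: bexI[of _ i] simp: order_less_le)
  finally show False
    by simp
qed

text \<open>With \<open>2 * d - 1\<close> edges each component is a maximal forest, hence a spanning
  tree.\<close>

lemma cf_connected: "\<lbrakk>i < d; u \<in> {1..2 * d}; v \<in> {1..2 * d}\<rbrakk> \<Longrightarrow> (u, v) \<in> conn (uedges (P ! i))"
  using cf_forest cf_edge cf_card by (intro max_forest_connected[of "{1..2 * d}"]) auto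

text \<open>Two sides of a triangle form a detour around the third, which could then not be a
  bridge. Hence the third side lies in another component.\<close>

lemma cf_no_triangle:
  assumes "i < d" "{x, y} \<in> uedges (P ! i)" "{y, z} \<in> uedges (P ! i)" "x \<noteq> z"
  shows "{x, z} \<notin> uedges (P ! i)"
proof
  assume "{x, z} \<in> uedges (P ! i)"
  moreover have "x \<noteq> y" "y \<noteq> z"
    using cf_edge[OF assms(1,2)] cf_edge[OF assms(1,3)] by auto
  then have "{x, y} \<noteq> {x, z}" "{y, z} \<noteq> {x, z}"
    by (auto simp: doubleton_eq_iff)
  then have "(x, y) \<in> conn (uedges (P ! i) - {{x, z}})" "(y, z) \<in> conn (uedges (P ! i) - {{x, z}})"
    using assms by (auto intro!: adj_conn)
  ultimately show False
    using forest_edge[OF cf_forest[OF assms(1)]] by (meson rtrancl_trans)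
qed

text \<open>Disjointness and covering survive because \<open>e\<close> and \<open>f\<close> merely
  trade components; acyclicity is what has to be supplied.\<close>

lemma cf_swap:
  assumes "i < d" "j < d" "i \<noteq> j" "e \<in> uedges (P ! i)" "f \<in> uedges (P ! j)"
    and "forest (insert f (uedges (P ! i) - {e}))" "forest (insert e (uedges (P ! j) - {f}))"
  shows "P[i := ({1..2 * d}, insert f (uedges (P ! i) - {e})),
           j := ({1..2 * d}, insert e (uedges (P ! j) - {f}))] \<in> cf_partitions d" (is "?Q \<in> _")
proof -
  define Q where "Q = ?Q"
  have ef: "e \<noteq> f"
    using assms cf_disjoint by blast
  have uniq: "e \<in> uedges (P ! k) \<longleftrightarrow> k = i" "f \<in> uedges (P ! k) \<longleftrightarrow> k = j" if "k < d" for k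
    using assms cf_disjoint that by blast+
  have Q: "uedges (Q ! k) = (if k = i then insert f (uedges (P ! i) - {e})
      else if k = j then insert e (uedges (P ! j) - {f}) else uedges (P ! k))" if "k < d" for k
    using assms cf_length that by (auto simp: Q_def nth_list_update)
  have mem: "g \<in> uedges (Q ! k) \<longleftrightarrow>
      (if g = e then k = j else if g = f then k = i else g \<in> uedges (P ! k))" if "k < d" for g k
    using Q[OF that] uniq[OF that] assms(3-5) ef by (cases "k = i"; cases "k = j") simp_all
  have "Q \<in> cf_partitions d"
    unfolding cf_partitions_iff
  proof (intro conjI allI impI)
    fix k
    assume "k < d"
    then show "uverts (Q ! k) = {1..2 * d}" "forest (uedges (Q ! k))"
      using assms cf_length cf_verts cf_forest by (auto simp: Q_def nth_list_update)
  next
    fix k l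
    assume "k < d" "l < d" "k \<noteq> l"
    have "\<not> (g \<in> uedges (Q ! k) \<and> g \<in> uedges (Q ! l))" for g
      using mem[OF \<open>k < d\<close>, of g] mem[OF \<open>l < d\<close>, of g] cf_disjoint[OF \<open>k < d\<close> \<open>l < d\<close>, of g] \<open>k \<noteq> l\<close>
      by (cases "g = e"; cases "g = f") auto
    then show "uedges (Q ! k) \<inter> uedges (Q ! l) = {}"
      by blast
  next
    have "(\<exists>k<d. g \<in> uedges (Q ! k)) \<longleftrightarrow> (\<exists>k<d. g \<in> uedges (P ! k))" for g
      using assms(1,2,4,5) by (cases "g = e"; cases "g = f") (auto simp: mem cong: conj_cong)
    then have "(\<Union>k<d. uedges (Q ! k)) = (\<Union>k<d. uedges (P ! k))"
      by blast
    then show "(\<Union>k<d. uedges (Q ! k)) = uedges (complete_graph (2 * d))"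
      by (rule trans[OF _ cf_cover])
  qed (use cf_length in \<open>auto simp: Q_def\<close>)
  then show ?thesis
    by (simp add: Q_def)
qed

end

lemma cf_eqI:
  assumes "P \<in> cf_partitions d" "Q \<in> cf_partitions d"
    and "\<And>i e. i < d \<Longrightarrow> e \<in> uedges (P ! i) \<longleftrightarrow> e \<in> uedges (Q ! i)"
  shows "P = Q"
proof (rule nth_equalityI)
  show "length P = length Q"
    using assms(1,2) by (simp add: cf_length)
  fix i
  assume "i < length P"
  then have "i < d"
    using assms(1) by (simp add: cf_length)
  then show "P ! i = Q ! i"
    using assms by (intro prod_eqI set_eqI) (simp_all add: cf_verts)
qed

section \<open>Involutions at a triangle with two edges in one component\<close>

text \<open>The condition on \<open>Q\<close> in \<open>involution\<close>, stated for the edge set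
  \<open>T\<close> of the triangle so that the order of its vertices does not matter.\<close>

definition triangle_related ::
    "nat \<Rightarrow> nat set set \<Rightarrow> nat ugraph list \<Rightarrow> nat ugraph list \<Rightarrow> bool" where
  "triangle_related d T P Q \<longleftrightarrow>
     (\<forall>e \<in> uedges (complete_graph (2 * d)) - T. coincide_on P Q e) \<and>
     2 \<le> card {e \<in> T. \<not> coincide_on P Q e}"

lemma involution_alt:
  "involution d P x y z =
     (THE Q. Q \<in> cf_partitions d \<and> triangle_related d {{x, y}, {x, z}, {y, z}} P Q)"
  by (simp add: involution_def triangle_related_def)

text \<open>Counting edges, the colours on the triangle are preserved with multiplicity, so \<open>Q\<close> is
  determined by the edge that receives the colour \<open>j\<close> occurring once.\<close>

lemma triangle_related_colours:
  assumes P: "P \<in> cf_partitions d" and Q: "Q \<in> cf_partitions d"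
    and T: "T = {{x, y}, {x, z}, {y, z}}" and dist: "x \<noteq> y" "y \<noteq> z" "x \<noteq> z"
    and t: "t < d" "{x, y} \<in> uedges (P ! t)" "{y, z} \<in> uedges (P ! t)"
    and j: "j < d" "{x, z} \<in> uedges (P ! j)"
    and rel: "triangle_related d T P Q"
  shows "\<exists>f\<in>{{x, y}, {y, z}}. uedges (Q ! j) = insert f (uedges (P ! j) - {{x, z}}) \<and>
    uedges (Q ! t) = (uedges (P ! t) - T) \<union> (T - {f}) \<and>
    (\<forall>i<d. i \<noteq> j \<longrightarrow> i \<noteq> t \<longrightarrow> uedges (Q ! i) = uedges (P ! i))"
proof -
  have neq: "{x, y} \<noteq> {x, z}" "{x, y} \<noteq> {y, z}" "{y, z} \<noteq> {x, z}"
    using dist by (auto simp: doubleton_eq_iff)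
  have jt: "j \<noteq> t"
    using cf_no_triangle[OF P t(1)] t j dist by blast
  have cT: "card T = 3" "finite T"
    using neq by (auto simp: T)
  have out: "e \<in> uedges (Q ! i) \<longleftrightarrow> e \<in> uedges (P ! i)" if "i < d" "e \<notin> T" for e i
  proof (cases "e \<in> uedges (complete_graph (2 * d))")
    case True
    then show ?thesis
      using rel that cf_length[OF P] by (auto simp: triangle_related_def coincide_on_def)
  next
    case False
    then show ?thesis
      using that cf_cover[OF P] cf_cover[OF Q] by blast
  qed
  \<comment> \<open>Components of the same index have equally many edges, and \<open>P\<close> and
    \<open>Q\<close> agree outside \<open>T\<close>, so each index keeps its number of triangle
    edges.\<close>
  have count: "card (uedges (Q ! i) \<inter> T) = card (uedges (P ! i) \<inter> T)" if "i < d" for i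
  proof -
    have "uedges (Q ! i) - T = uedges (P ! i) - T"
      using out[OF that] by auto
    moreover have "card (uedges (Q ! i)) = card (uedges (P ! i))"
      using cf_card[OF P that] cf_card[OF Q that] by simp
    moreover have "card (uedges (R ! i)) = card (uedges (R ! i) - T) + card (uedges (R ! i) \<inter> T)"
      if "R \<in> cf_partitions d" for R
      using cf_finite[OF that \<open>i < d\<close>] by (metis Int_commute card_Int_Diff add.commute)
    ultimately show ?thesis
      using P Q by (metis add_left_cancel)
  qed
  have PT: "uedges (P ! j) \<inter> T = {{x, z}}" "uedges (P ! t) \<inter> T = {{x, y}, {y, z}}"
    using t j jt cf_disjoint[OF P] by (auto simp: T)
  have Pi: "uedges (P ! i) \<inter> T = {}" if "i < d" "i \<noteq> j" "i \<noteq> t" for i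
    using t j that cf_disjoint[OF P] by (auto simp: T)
  have "card (uedges (Q ! j) \<inter> T) = 1"
    using count[OF j(1)] PT by simp
  \<comment> \<open>\<open>f\<close> is the triangle edge that \<open>Q\<close> gives to
    \<open>j\<close>.\<close>
  then obtain f where f: "uedges (Q ! j) \<inter> T = {f}"
    by (meson card_1_singletonE)
  have "uedges (Q ! t) \<inter> T \<subseteq> T - {f}"
    using f jt cf_disjoint[OF Q] t(1) j(1) by blast
  moreover have "card (uedges (Q ! t) \<inter> T) = card (T - {f})"
  proof -
    have "f \<in> T"
      using f by blast
    then show ?thesis
      using count[OF t(1)] PT(2) neq(2) cT by simp
  qed
  ultimately have Qt: "uedges (Q ! t) \<inter> T = T - {f}"
    using cT by (intro card_subset_eq) auto
  have Qi: "uedges (Q ! i) \<inter> T = {}" if "i < d" "i \<noteq> j" "i \<noteq> t" for i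
    using count[OF that(1)] Pi[OF that] cT by simp
  \<comment> \<open>If \<open>j\<close> kept \<open>{x, z}\<close>, the counts would leave all of
    \<open>T\<close> unchanged, but \<open>Q\<close> must differ on at least two edges.\<close>
  have "f \<noteq> {x, z}"
  proof
    assume fz: "f = {x, z}"
    have "e \<in> uedges (P ! i) \<longleftrightarrow> e \<in> uedges (Q ! i)" if "i < d" for i e
    proof (cases "e \<in> T")
      case True
      have "uedges (P ! i) \<inter> T = uedges (Q ! i) \<inter> T"
        using that PT Qt Pi Qi f fz neq
        by (cases "i = j"; cases "i = t") (auto simp: T)
      then show ?thesis
        using True by blast
    qed (use out that in auto)
    then have "coincide_on P Q e" for e
      using cf_length[OF P] by (auto simp: coincide_on_def)
    then show False
      using rel by (simp add: triangle_related_def)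
  qed
  moreover have "f \<in> T"
    using f by blast
  ultimately have "f \<in> {{x, y}, {y, z}}"
    by (auto simp: T)
  moreover have U: "uedges (Q ! i) = (uedges (P ! i) - T) \<union> (uedges (Q ! i) \<inter> T)" if "i < d" for i
    using out[OF that] by blast
  have "uedges (Q ! j) = insert f (uedges (P ! j) - {{x, z}})"
    using U[OF j(1)] f PT(1) by blast
  moreover have "uedges (Q ! t) = (uedges (P ! t) - T) \<union> (T - {f})"
    using U[OF t(1)] unfolding Qt .
  moreover have "uedges (Q ! i) = uedges (P ! i)" if "i < d" "i \<noteq> j" "i \<noteq> t" for i
    using U[OF that(1)] Qi[OF that] Pi[OF that] by blast
  ultimately show ?thesis
    by (intro bexI[of _ f]) simp_all
qed

text \<open>By the colour count, the only freedom is whether component \<open>j\<close> trades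
  \<open>{x, z}\<close> for \<open>{x, y}\<close> or for \<open>{y, z}\<close>. If both trades were
  possible, \<open>x\<close>, \<open>y\<close>, \<open>z\<close> would lie in three different pieces
  of this tree minus one edge, which has only two.\<close>

lemma triangle_related_unique:
  assumes P: "P \<in> cf_partitions d" and Q: "Q \<in> cf_partitions d" and Q': "Q' \<in> cf_partitions d"
    and T: "T = {{x, y}, {x, z}, {y, z}}" and dist: "x \<noteq> y" "y \<noteq> z" "x \<noteq> z"
    and t: "t < d" "{x, y} \<in> uedges (P ! t)" "{y, z} \<in> uedges (P ! t)"
    and rel: "triangle_related d T P Q" "triangle_related d T P Q'"
  shows "Q = Q'"
proof -
  have verts: "x \<in> {1..2 * d}" "z \<in> {1..2 * d}"
    using cf_edge[OF P t(1)] t by blast+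
  then have "{x, z} \<in> uedges (complete_graph (2 * d))"
    using dist by (simp add: complete_edges)
  then obtain j where j: "j < d" "{x, z} \<in> uedges (P ! j)"
    using cf_cover[OF P] by blast
  define F where "F = uedges (P ! j) - {{x, z}}"
  note col = triangle_related_colours[OF P _ T dist t j, folded F_def]
  obtain f where f: "f \<in> {{x, y}, {y, z}}" "uedges (Q ! j) = insert f F"
    "uedges (Q ! t) = (uedges (P ! t) - T) \<union> (T - {f})"
    "\<And>i. i < d \<Longrightarrow> i \<noteq> j \<Longrightarrow> i \<noteq> t \<Longrightarrow> uedges (Q ! i) = uedges (P ! i)"
    using col[OF Q rel(1)] by blast
  obtain g where g: "g \<in> {{x, y}, {y, z}}" "uedges (Q' ! j) = insert g F"
    "uedges (Q' ! t) = (uedges (P ! t) - T) \<union> (T - {g})"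
    "\<And>i. i < d \<Longrightarrow> i \<noteq> j \<Longrightarrow> i \<noteq> t \<Longrightarrow> uedges (Q' ! i) = uedges (P ! i)"
    using col[OF Q' rel(2)] by blast
  have "f = g"
  proof (rule ccontr)
    assume "f \<noteq> g"
    then have forests: "forest (insert {x, y} F)" "forest (insert {y, z} F)"
      using f g cf_forest[OF Q j(1)] cf_forest[OF Q' j(1)] by auto
    have neq: "{x, y} \<noteq> {x, z}" "{x, y} \<noteq> {y, z}" "{y, z} \<noteq> {x, z}"
      using dist by (auto simp: doubleton_eq_iff)
    have jt: "j \<noteq> t"
      using cf_no_triangle[OF P t(1)] t j dist by blast
    then have notin: "{x, y} \<notin> F" "{y, z} \<notin> F"
      using cf_disjoint[OF P j(1) t(1)] t by (auto simp: F_def)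
    then have apart: "(x, y) \<notin> conn F" "(y, z) \<notin> conn F"
      using forest_edge[OF forests(1), of x y] forest_edge[OF forests(2), of y z] by auto
    have xz: "(x, z) \<notin> conn F"
      using forest_edge[OF cf_forest[OF P j(1)] j(2)] by (simp add: F_def)
    \<comment> \<open>Each alternative of \<open>conn_insert\<close> would join two of
      \<open>x\<close>, \<open>y\<close>, \<open>z\<close> inside \<open>F\<close>.\<close>
    then have "(y, z) \<notin> conn (insert {x, y} F)"
      using apart conn_insert[of y z x y F] by (auto dest: conn_sym)
    then have "forest (insert {y, z} (insert {x, y} F))"
      by (rule forest_insert[OF forests(1)])
    \<comment> \<open>\<open>F\<close> has \<open>2 * d - 2\<close> edges; two more make as many
      edges as vertices, too many for a forest.\<close>
    moreover have "card (insert {y, z} (insert {x, y} F)) = 2 * d"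
      using cf_finite[OF P j(1)] cf_card[OF P j(1)] j notin neq
      by (auto simp: F_def card_Diff_singleton)
    moreover have "\<forall>e\<in>insert {y, z} (insert {x, y} F). e \<subseteq> {1..2 * d} \<and> card e = 2"
      using cf_edge[OF P t(1) t(2)] cf_edge[OF P t(1) t(3)] cf_edge[OF P j(1)] by (auto simp: F_def)
    ultimately show False
      using forest_card_less[of "{1..2 * d}" "insert {y, z} (insert {x, y} F)"] verts by auto
  qed
  then show ?thesis
    using f g Q Q' by (intro cf_eqI[of _ d]) metis+
qed

text \<open>Involution steps demand increasing vertices, while the arguments name them by their role
  in the triangle.\<close>

lemma triangle_sorted:
  fixes x y z :: nat
  assumes "x \<noteq> y" "y \<noteq> z" "x \<noteq> z"
  obtains a b c where "a < b" "b < c" "{a, b, c} = {x, y, z}"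
    "{{a, b}, {a, c}, {b, c}} = {{x, y}, {x, z}, {y, z}}"
proof -
  consider "x < y" "y < z" | "x < z" "z < y" | "y < x" "x < z" | "y < z" "z < x"
    | "z < x" "x < y" | "z < y" "y < x"
    using assms by linarith
  then show ?thesis
    by cases (erule (1) that; auto simp: insert_commute)+
qed

text \<open>The involution is applied to the later partition \<open>Q\<close> and returns the
  earlier \<open>P\<close>, following the index convention of
  \<open>involution_equivalent\<close>.\<close>

definition involution_step :: "nat \<Rightarrow> nat ugraph list \<Rightarrow> nat ugraph list \<Rightarrow> bool" where
  "involution_step d P Q \<longleftrightarrow> (\<exists>x y z. 1 \<le> x \<and> x < y \<and> y < z \<and> z \<le> 2 * d \<and> involution d Q x y z = P)"

text \<open>The definite description is evaluated at \<open>Q\<close>, so uniqueness is needed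
  there; it comes from two triangle edges sharing a component of \<open>Q\<close>.\<close>

lemma involution_stepI:
  assumes P: "P \<in> cf_partitions d" and Q: "Q \<in> cf_partitions d"
    and dist: "x \<noteq> y" "y \<noteq> z" "x \<noteq> z"
    and t: "t < d" "{x, y} \<in> uedges (Q ! t)" "{y, z} \<in> uedges (Q ! t)"
    and rel: "triangle_related d {{x, y}, {x, z}, {y, z}} Q P"
  shows "involution_step d P Q"
proof -
  obtain a b c where abc: "a < b" "b < c" "{a, b, c} = {x, y, z}"
    "{{a, b}, {a, c}, {b, c}} = {{x, y}, {x, z}, {y, z}}"
    using triangle_sorted[OF dist] by metis
  have "{x, y, z} \<subseteq> {1..2 * d}"
    using cf_edge[OF Q t(1)] t by blast
  then have "{a, b, c} \<subseteq> {1..2 * d}"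
    by (simp only: abc)
  moreover have "involution d Q a b c = P"
    unfolding involution_alt abc(4)
  proof (rule the_equality)
    fix R
    assume "R \<in> cf_partitions d \<and> triangle_related d {{x, y}, {x, z}, {y, z}} Q R"
    then show "R = P"
      using triangle_related_unique[OF Q _ P refl dist t _ rel] by blast
  qed (use P rel in blast)
  ultimately show ?thesis
    unfolding involution_step_def using abc(1,2) by fastforce
qed

text \<open>Component \<open>t\<close> trades \<open>{x, y}\<close> for \<open>{x, z}\<close> by
  \<open>forest_exchange\<close>. Component \<open>j\<close> makes the opposite trade and stays a
  forest because of \<open>xy\<close>.\<close>

lemma triangle_swap:
  assumes P: "P \<in> cf_partitions d"
    and dist: "x \<noteq> y" "y \<noteq> z" "x \<noteq> z"
    and t: "t < d" "{x, y} \<in> uedges (P ! t)" "{y, z} \<in> uedges (P ! t)"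
    and j: "j < d" "{x, z} \<in> uedges (P ! j)"
    and xy: "(x, y) \<notin> conn (uedges (P ! j) - {{x, z}})"
  shows "\<exists>Q\<in>cf_partitions d. involution_step d P Q \<and>
    uedges (Q ! t) = insert {x, z} (uedges (P ! t) - {{x, y}})"
proof -
  have neq: "{x, y} \<noteq> {x, z}" "{x, y} \<noteq> {y, z}" "{y, z} \<noteq> {x, z}"
    using dist by (auto simp: doubleton_eq_iff)
  have jt: "j \<noteq> t"
    using cf_no_triangle[OF P t(1)] t j dist by blast
  let ?A = "insert {x, z} (uedges (P ! t) - {{x, y}})"
  let ?B = "insert {x, y} (uedges (P ! j) - {{x, z}})"
  define Q where "Q = P[t := ({1..2 * d}, ?A), j := ({1..2 * d}, ?B)]"
  have "forest ?A"
    using cf_forest[OF P t(1)] t neq by (intro forest_exchange) auto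
  moreover have "forest ?B"
    using xy cf_forest[OF P j(1)] by (intro forest_insert) (auto elim: forest_subset)
  ultimately have Q: "Q \<in> cf_partitions d"
    unfolding Q_def using t j jt by (intro cf_swap[OF P]) auto
  have Qt: "uedges (Q ! t) = ?A" and Qj: "uedges (Q ! j) = ?B"
    and Qi: "i \<noteq> t \<Longrightarrow> i \<noteq> j \<Longrightarrow> Q ! i = P ! i" for i
    using t j jt cf_length[OF P] by (auto simp: Q_def)
  have co: "coincide_on Q P e" if "e \<noteq> {x, y}" "e \<noteq> {x, z}" for e
    unfolding coincide_on_def using that Qt Qj Qi by (metis Diff_iff insert_iff singletonD)
  have nco: "\<not> coincide_on Q P {x, y}" "\<not> coincide_on Q P {x, z}"
  proof -
    have "{x, y} \<in> uedges (Q ! j)" "{x, z} \<in> uedges (Q ! t)"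
      by (simp_all add: Qt Qj)
    moreover have "{x, y} \<notin> uedges (P ! j)" "{x, z} \<notin> uedges (P ! t)"
      using t j jt cf_disjoint[OF P] by blast+
    ultimately show "\<not> coincide_on Q P {x, y}" "\<not> coincide_on Q P {x, z}"
      unfolding coincide_on_def using t(1) j(1) cf_length[OF Q] by blast+
  qed
  \<comment> \<open>In component \<open>t\<close> of \<open>Q\<close> the two triangle edges meet at
    \<open>z\<close>, so \<open>z\<close> takes the middle position.\<close>
  have "{e \<in> {{x, z}, {x, y}, {z, y}}. \<not> coincide_on Q P e} = {{x, y}, {x, z}}"
    using co[of "{y, z}"] nco neq by (auto simp: insert_commute)
  then have rel: "triangle_related d {{x, z}, {x, y}, {z, y}} Q P"
    unfolding triangle_related_def using co neq by auto
  have "involution_step d P Q"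
    using Qt t neq dist by (intro involution_stepI[OF P Q _ _ _ t(1) _ _ rel]) (auto simp: insert_commute)
  then show ?thesis
    using Q Qt by blast
qed

text \<open>Deleting \<open>{x, z}\<close> from its component separates \<open>x\<close> from
  \<open>z\<close>, so \<open>y\<close> is cut off from at least one of them, and the edge from that
  end to \<open>y\<close> can be traded.\<close>

lemma triangle_move:
  assumes P: "P \<in> cf_partitions d"
    and dist: "x \<noteq> y" "y \<noteq> z" "x \<noteq> z"
    and t: "t < d" "{x, y} \<in> uedges (P ! t)" "{y, z} \<in> uedges (P ! t)"
  obtains Q where "Q \<in> cf_partitions d" "involution_step d P Q"
    "uedges (Q ! t) = insert {x, z} (uedges (P ! t) - {{x, y}}) \<or>
     uedges (Q ! t) = insert {x, z} (uedges (P ! t) - {{y, z}})"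
proof -
  have "x \<in> {1..2 * d}" "z \<in> {1..2 * d}"
    using cf_edge[OF P t(1)] t by blast+
  then have "{x, z} \<in> uedges (complete_graph (2 * d))"
    using dist by (simp add: complete_edges)
  then obtain j where j: "j < d" "{x, z} \<in> uedges (P ! j)"
    using cf_cover[OF P] by blast
  let ?F = "uedges (P ! j) - {{x, z}}"
  have "(x, z) \<notin> conn ?F"
    using forest_edge[OF cf_forest[OF P j(1)] j(2)] .
  then consider "(x, y) \<notin> conn ?F" | "(z, y) \<notin> conn ?F"
    using conn_sym by (meson rtrancl_trans)
  then show ?thesis
  proof cases
    case 1
    then show ?thesis
      using triangle_swap[OF P dist t j] that by blast
  next
    case 2
    then have "\<exists>Q\<in>cf_partitions d. involution_step d P Q \<and>
      uedges (Q ! t) = insert {z, x} (uedges (P ! t) - {{z, y}})"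
      using t j dist by (intro triangle_swap[OF P, where j = j]) (auto simp: insert_commute)
    then show ?thesis
      using that by (metis insert_commute)
  qed
qed

section \<open>Chaining involutions\<close>

lemma involution_equivalent_refl:
  "P \<in> cf_partitions d \<Longrightarrow> involution_equivalent d P P"
  unfolding involution_equivalent_def by (rule exI[of _ 0], rule exI[of _ "\<lambda>_. P"]) simp

lemma involution_equivalent_step:
  assumes "involution_equivalent d P Q" "Q' \<in> cf_partitions d" "involution_step d Q Q'"
  shows "involution_equivalent d P Q'"
proof -
  obtain n :: nat and R x y z where R: "\<forall>i\<le>n. R i \<in> cf_partitions d" "R 0 = P" "R n = Q"
    "\<forall>i\<in>{1..n}. 1 \<le> x i \<and> x i < y i \<and> y i < z i \<and> z i \<le> 2 * d \<and>
       involution d (R i) (x i) (y i) (z i) = R (i - 1)"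
    using assms(1) unfolding involution_equivalent_def by blast
  obtain a b c where abc: "1 \<le> a" "a < b" "b < c" "c \<le> 2 * d" "involution d Q' a b c = Q"
    using assms(3) unfolding involution_step_def by blast
  let ?R = "R(Suc n := Q')" and ?x = "x(Suc n := a)" and ?y = "y(Suc n := b)"
    and ?z = "z(Suc n := c)"
  have "1 \<le> ?x i \<and> ?x i < ?y i \<and> ?y i < ?z i \<and> ?z i \<le> 2 * d \<and>
      involution d (?R i) (?x i) (?y i) (?z i) = ?R (i - 1)" if "i \<in> {1..Suc n}" for i
    using that R(3,4) abc by (cases "i = Suc n") auto
  then show ?thesis
    unfolding involution_equivalent_def using R assms(2)
    by (intro exI[of _ "Suc n"] exI[of _ ?R] exI[of _ ?x] exI[of _ ?y] exI[of _ ?z])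
       (auto simp: le_Suc_eq)
qed

section \<open>Growing a path\<close>

text \<open>A walk in the spanning tree from a listed vertex to a missed one must leave the list
  along some edge.\<close>

lemma exists_off_path:
  assumes P: "P \<in> cf_partitions d" "t < d"
    and ps: "ps \<noteq> []" "distinct ps" "set ps \<subseteq> {1..2 * d}" "length ps \<noteq> 2 * d"
  obtains u v where "v \<in> set ps" "u \<notin> set ps" "{v, u} \<in> uedges (P ! t)"
proof -
  have "set ps \<noteq> {1..2 * d}"
    using ps(2,4) distinct_card[of ps] by auto
  then obtain w where w: "w \<in> {1..2 * d}" "w \<notin> set ps"
    using ps(3) by blast
  have "hd ps \<in> {1..2 * d}"
    using ps(1,3) hd_in_set by blast
  then have "(hd ps, w) \<in> conn (uedges (P ! t))"
    using cf_connected[OF P] w(1) by blast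
  \<comment> \<open>The implication makes the start of the walk trivial, as \<open>hd ps\<close> is
    listed; the first step off the list then provides the edge.\<close>
  then have "w \<notin> set ps \<longrightarrow> (\<exists>v\<in>set ps. \<exists>u. u \<notin> set ps \<and> {v, u} \<in> uedges (P ! t))"
    by (induction rule: rtrancl_induct) (use ps(1) in \<open>auto simp: adj_def\<close>)
  then show ?thesis
    using w that by blast
qed

text \<open>The parts before and after \<open>{v, w}\<close> do not use that edge; the old
  \<open>{u, v}\<close> and the new \<open>{u, w}\<close> link them through
  \<open>u\<close>.\<close>

lemma path_insert_between:
  assumes "distinct (as @ v # w # bs)" "edge_path E (as @ v # w # bs)"
    and "u \<notin> set (as @ v # w # bs)" "{u, v} \<in> E"
  shows "edge_path (insert {u, w} (E - {{v, w}})) (as @ v # u # w # bs)"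
proof -
  have "edge_path E (as @ [v])" "edge_path E (w # bs)"
    using assms(2) by (auto simp: successively_append_iff)
  moreover have "\<not> {v, w} \<subseteq> set (as @ [v])" "\<not> {v, w} \<subseteq> set (w # bs)"
    using assms(1) by auto
  ultimately have "edge_path (E - {{v, w}}) (as @ [v])" "edge_path (E - {{v, w}}) (w # bs)"
    by (blast intro: edge_path_Diff)+
  then have "edge_path (insert {u, w} (E - {{v, w}})) (as @ [v])"
    "edge_path (insert {u, w} (E - {{v, w}})) (w # bs)"
    by (blast intro: edge_path_mono)+
  moreover have "{v, u} \<in> E - {{v, w}}"
    using assms by (auto simp: insert_commute doubleton_eq_iff)
  ultimately show ?thesis
    by (auto simp: successively_append_iff)
qed

text \<open>Induction on \<open>bs\<close>, the part of the path beyond the attachment point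
  \<open>v\<close>, for all \<open>P\<close>: the involution either inserts \<open>u\<close> between
  \<open>v\<close> and \<open>w\<close> or makes \<open>w\<close> the attachment point, with a
  shorter rest.\<close>

lemma extend_path:
  assumes "P \<in> cf_partitions d" "involution_equivalent d \<Gamma> P" "t < d"
    and "distinct (as @ v # bs)" "set (as @ v # bs) \<subseteq> {1..2 * d}"
    and "edge_path (uedges (P ! t)) (as @ v # bs)"
    and "u \<notin> set (as @ v # bs)" "{u, v} \<in> uedges (P ! t)"
  shows "\<exists>Q\<in>cf_partitions d. involution_equivalent d \<Gamma> Q \<and>
    (\<exists>qs. length qs = Suc (length (as @ v # bs)) \<and> distinct qs \<and> set qs \<subseteq> {1..2 * d} \<and>
      edge_path (uedges (Q ! t)) qs)"
  using assms
proof (induction bs arbitrary: P as v)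
  case Nil
  have "u \<in> {1..2 * d}"
    using cf_edge[OF Nil.prems(1,3,8)] by blast
  then show ?case
    using Nil.prems by (intro bexI[of _ P] conjI exI[of _ "as @ [v, u]"])
      (auto simp: successively_append_iff insert_commute)
next
  case (Cons w bs)
  let ?E = "uedges (P ! t)"
  have u: "u \<in> {1..2 * d}"
    using cf_edge[OF Cons.prems(1,3,8)] by blast
  have vw: "{v, w} \<in> ?E"
    using Cons.prems(6) by (auto simp: successively_append_iff)
  have dist: "u \<noteq> v" "v \<noteq> w" "u \<noteq> w"
    using Cons.prems(4,7) by auto
  obtain Q where Q: "Q \<in> cf_partitions d" "involution_step d P Q"
    and cases: "uedges (Q ! t) = insert {u, w} (?E - {{u, v}}) \<or>
      uedges (Q ! t) = insert {u, w} (?E - {{v, w}})"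
    using triangle_move[OF Cons.prems(1) dist Cons.prems(3,8) vw] by metis
  have equiv: "involution_equivalent d \<Gamma> Q"
    using involution_equivalent_step Cons.prems(2) Q by blast
  from cases show ?case
  proof
    assume E: "uedges (Q ! t) = insert {u, w} (?E - {{v, w}})"
    have "edge_path (uedges (Q ! t)) (as @ v # u # w # bs)"
      unfolding E using Cons.prems by (intro path_insert_between) auto
    then show ?thesis
      using Q equiv u Cons.prems by (intro bexI[of _ Q] conjI exI[of _ "as @ v # u # w # bs"]) auto
  next
    assume E: "uedges (Q ! t) = insert {u, w} (?E - {{u, v}})"
    \<comment> \<open>\<open>u\<close> is off the path, so the path survives the loss of
      \<open>{u, v}\<close>.\<close>
    have "edge_path (?E - {{u, v}}) (as @ v # w # bs)"
      using Cons.prems by (intro edge_path_Diff) auto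
    then have "edge_path (uedges (Q ! t)) (as @ v # w # bs)"
      unfolding E by (rule edge_path_mono) auto
    then show ?thesis
      using Cons.IH[of Q "as @ [v]" w] Q equiv Cons.prems E by auto
  qed
qed

text \<open>From a single vertex, \<open>extend_path\<close> gains one vertex at a time while the
  path is not spanning.\<close>

lemma exists_path:
  assumes "\<Gamma> \<in> cf_partitions d" "t < d" "1 \<le> n" "n \<le> 2 * d"
  shows "\<exists>Q\<in>cf_partitions d. involution_equivalent d \<Gamma> Q \<and>
    (\<exists>qs. length qs = n \<and> distinct qs \<and> set qs \<subseteq> {1..2 * d} \<and> edge_path (uedges (Q ! t)) qs)"
  using assms(3,4)
proof (induction n rule: dec_induct)
  case base
  then show ?case
    using assms by (intro bexI[of _ \<Gamma>] conjI exI[of _ "[1]"])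
      (auto intro: involution_equivalent_refl)
next
  case (step n)
  then obtain Q qs where Q: "Q \<in> cf_partitions d" "involution_equivalent d \<Gamma> Q"
    and qs: "length qs = n" "distinct qs" "set qs \<subseteq> {1..2 * d}" "edge_path (uedges (Q ! t)) qs"
    by auto
  have "qs \<noteq> []" "length qs \<noteq> 2 * d"
    using qs(1) step by auto
  then obtain u v where uv: "v \<in> set qs" "u \<notin> set qs" "{v, u} \<in> uedges (Q ! t)"
    using exists_off_path[OF Q(1) assms(2) _ qs(2,3)] by metis
  then obtain as bs where "qs = as @ v # bs"
    by (auto simp: in_set_conv_decomp)
  then show ?case
    using extend_path[OF Q assms(2), of as v bs u] qs uv by (auto simp: insert_commute)
qed

section \<open>From a spanning path to the path graph\<close>

text \<open>The bijection runs from \<open>H\<close> to \<open>G\<close>, as a list of the vertices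
  of \<open>G\<close> provides it; its inverse is the isomorphism. Comparing whole edge sets allows
  a counting argument.\<close>

lemma graph_isomorphicI:
  assumes g: "bij_betw g (uverts H) (uverts G)" and E: "uedges G = (`) g ` uedges H"
    and H: "\<forall>e\<in>uedges H. e \<subseteq> uverts H"
  shows "graph_isomorphic G H"
  unfolding graph_isomorphic_def
proof (intro exI conjI ballI)
  let ?f = "inv_into (uverts H) g"
  show "bij_betw ?f (uverts G) (uverts H)"
    using g by (rule bij_betw_inv_into)
  fix u v
  assume "u \<in> uverts G" "v \<in> uverts G"
  then have f: "g (?f u) = u" "g (?f v) = v" "?f u \<in> uverts H" "?f v \<in> uverts H"
    using g by (auto simp: bij_betw_def f_inv_into_f inv_into_into)
  have "{?f u, ?f v} \<in> uedges H" if e: "e \<in> uedges H" "{u, v} = g ` e" for e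
  proof -
    have "g ` e = g ` {?f u, ?f v}"
      using e f by simp
    then have "e = {?f u, ?f v}"
      using inj_on_image_eq_iff[of g "uverts H" e "{?f u, ?f v}"] g H e f
      by (auto simp: bij_betw_def)
    then show ?thesis
      using e by simp
  qed
  moreover have "{u, v} = g ` {?f u, ?f v}"
    using f by simp
  ultimately show "{u, v} \<in> uedges G \<longleftrightarrow> {?f u, ?f v} \<in> uedges H"
    unfolding E by blast
qed

lemma card_path_graph: "card (uedges (path_graph n)) = n - 1"
proof -
  have "uedges (path_graph n) = (\<lambda>i. {i, i + 1}) ` {1..<n}"
    by (auto simp: path_graph_def)
  moreover have "inj_on (\<lambda>i::nat. {i, i + 1}) {1..<n}"
    by (auto simp: inj_on_def doubleton_eq_iff)
  ultimately show ?thesis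
    by (simp add: card_image)
qed

text \<open>Reading off \<open>qs\<close> maps the \<open>n - 1\<close> edges of the path graph
  injectively into the \<open>n - 1\<close> edges of \<open>G\<close>, hence onto them.\<close>

lemma spanning_path_isomorphic:
  assumes verts: "uverts G = {1..n}" and E: "finite (uedges G)" "card (uedges G) = n - 1"
    and qs: "length qs = n" "distinct qs" "set qs \<subseteq> {1..n}" "edge_path (uedges G) qs"
  shows "graph_isomorphic G (path_graph n)"
proof (rule graph_isomorphicI)
  \<comment> \<open>Vertices are numbered from \<open>1\<close>, list entries from
    \<open>0\<close>.\<close>
  let ?g = "\<lambda>i. qs ! (i - 1)"
  have inj: "inj_on ?g {1..n}"
    using qs by (auto simp: inj_on_def nth_eq_iff_index_eq)
  moreover have "?g ` {1..n} \<subseteq> {1..n}"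
  proof (rule image_subsetI)
    fix i
    assume "i \<in> {1..n}"
    then have "?g i \<in> set qs"
      using qs(1) by (intro nth_mem) auto
    then show "?g i \<in> {1..n}"
      using qs(3) by blast
  qed
  ultimately have "?g ` {1..n} = {1..n}"
    by (intro endo_inj_surj) auto
  then show "bij_betw ?g (uverts (path_graph n)) (uverts G)"
    using inj verts by (simp add: bij_betw_def path_graph_def)
  show sub: "\<forall>e\<in>uedges (path_graph n). e \<subseteq> uverts (path_graph n)"
    by (auto simp: path_graph_def)
  have "inj_on ((`) ?g) (uedges (path_graph n))"
    using inj sub by (intro inj_on_subset[OF inj_on_image_Pow[OF inj]]) (auto simp: path_graph_def)
  then have "card ((`) ?g ` uedges (path_graph n)) = card (uedges G)"
    by (simp add: card_image card_path_graph E)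
  moreover have "(`) ?g ` uedges (path_graph n) \<subseteq> uedges G"
    using qs by (auto simp: path_graph_def successively_conv_nth)
      (metis One_nat_def Suc_pred less_le_trans zero_less_one)
  ultimately show "uedges G = (`) ?g ` uedges (path_graph n)"
    using E by (metis card_subset_eq)
qed

theorem theorem3p9:
  fixes d :: nat and \<Gamma> :: "nat ugraph list"
  assumes "1 \<le> d"
    and "\<Gamma> \<in> cf_partitions d"
  shows "\<exists>\<Upsilon> \<in> cf_partitions d. involution_equivalent d \<Gamma> \<Upsilon> \<and>
           graph_isomorphic (\<Upsilon> ! (d - 1)) (path_graph (2 * d))"
proof -
  \<comment> \<open>\<open>d - 1\<close> is the list index of the last component.\<close>
  have t: "d - 1 < d"
    using assms(1) by simp
  obtain Q qs where Q: "Q \<in> cf_partitions d" "involution_equivalent d \<Gamma> Q"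
    and qs: "length qs = 2 * d" "distinct qs" "set qs \<subseteq> {1..2 * d}"
      "edge_path (uedges (Q ! (d - 1))) qs"
    using exists_path[OF assms(2) t, of "2 * d"] assms(1) by auto
  have "graph_isomorphic (Q ! (d - 1)) (path_graph (2 * d))"
    by (rule spanning_path_isomorphic[OF _ _ _ qs])
      (use cf_verts[OF Q(1) t] cf_finite[OF Q(1) t] cf_card[OF Q(1) t] in auto)
  then show ?thesis
    using Q by blast
qed

end
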